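(* Let $\mathcal{H}$ be a hypergraph. Then $$hk(\mathcal{H}) \geq |E(\mathcal{H})|-|V(\mathcal{H})|+\min_{e\in E(\mathcal{H})}|e|.$$
   Context: A hypergraph $\mathcal{H}$ consists of a finite vertex set $V(\mathcal{H})$ and a set $E(\mathcal{H})$ of subsets of $V(\mathcal{H})$ called hyperedges. All hypergraphs considered may have isolated vertices (vertices contained in no hyperedge) but have no loops (hyperedges consisting of exactly one vertex), so every hyperedge has at least two vertices. For a finite set $I$ disjoint from $V(\mathcal{H})$, $\mathcal{H}\cup I$ is the hypergraph with vertex set $V(\mathcal{H})\cup I$ and hyperedge set $E(\mathcal{H})$. For a digraph $D$ with vertex set $V(D)$ and arc set $A(D)$, the in-neighborhood of a vertex $v$ is $N_D^-(v)=\{x\in V(D) : (x,v)\in A(D)\}$. The competition hypergraph $C\mathcal{H}(D)$ of $D$ is the hypergraph with vertex set $V(D)$ in which $e\subseteq V(D)$ is a hyperedge if and only if $e$ contains at least $2$ vertices and $e=N_D^-(v)$ for some vertex $v$ of $D$. Any hypergraph $\mathcal{H}$ together with sufficiently many additional isolated vertices is the competition hypergraph of an acyclic digraph (one with no directed cycles, in particular no loops). The hypercompetition number $hk(\mathcal{H})$ is the smallest number of such isolated vertices, that is, the smallest integer $k\ge 0$ such that $\mathcal{H}\cup I$, where $I$ is a set of $k$ new isolated vertices, is the competition hypergraph of some acyclic digraph. *)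

theory Defs
  imports "Graph_Theory.Pair_Digraph"
begin

record 'a pre_hypergraph =
  hverts :: "'a set"
  hedges :: "'a set set"

locale hypergraph =
  fixes H :: "'a pre_hypergraph"
  assumes finite_hverts: "finite (hverts H)"
    and hedges_subset: "e \<in> hedges H \<Longrightarrow> e \<subseteq> hverts H"
    and hedges_card: "e \<in> hedges H \<Longrightarrow> 2 \<le> card e"

definition add_isolated :: "'a pre_hypergraph \<Rightarrow> 'a set \<Rightarrow> 'a pre_hypergraph" where
  "add_isolated H I = \<lparr>hverts = hverts H \<union> I, hedges = hedges H\<rparr>"

definition rename_vertices :: "('a \<Rightarrow> 'b) \<Rightarrow> 'a pre_hypergraph \<Rightarrow> 'b pre_hypergraph" where
  "rename_vertices f H = \<lparr>hverts = f ` hverts H, hedges = (\<lambda>e. f ` e) ` hedges H\<rparr>"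

definition in_neighborhood :: "'a pair_pre_digraph \<Rightarrow> 'a \<Rightarrow> 'a set" where
  "in_neighborhood D v = {x \<in> pverts D. (x, v) \<in> parcs D}"

definition competition_hypergraph :: "'a pair_pre_digraph \<Rightarrow> 'a pre_hypergraph" where
  "competition_hypergraph D =
     \<lparr>hverts = pverts D,
      hedges = {e. e \<subseteq> pverts D \<and> 2 \<le> card e \<and> (\<exists>v\<in>pverts D. e = in_neighborhood D v)}\<rparr>"

definition is_acyclic_competition_hypergraph :: "'a pre_hypergraph \<Rightarrow> bool" where
  "is_acyclic_competition_hypergraph H \<longleftrightarrow>
     (\<exists>D. pair_fin_digraph D \<and> acyclic (parcs D) \<and> H = competition_hypergraph D)"

text \<open>
  The vertex type \<open>'a\<close> may be finite and so too small to supply new vertices. The set of new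
  vertices is therefore taken in \<open>'a + nat\<close>, in which \<open>H\<close> is embedded along \<open>Inl\<close>.
\<close>

definition hk_admissible :: "'a pre_hypergraph \<Rightarrow> nat \<Rightarrow> bool" where
  "hk_admissible H k \<longleftrightarrow>
     (let H' = rename_vertices Inl H :: ('a + nat) pre_hypergraph in
      \<exists>I. finite I \<and> I \<inter> hverts H' = {} \<and> card I = k \<and>
          is_acyclic_competition_hypergraph (add_isolated H' I))"

definition hypercompetition_number :: "'a pre_hypergraph \<Rightarrow> nat" where
  "hypercompetition_number H = (LEAST k. hk_admissible H k)"

text \<open>For every hypergraph the minimum ranges over a nonempty set: one new vertex per
  hyperedge suffices.\<close>

lemma (in hypergraph) hk_admissible_exists: "\<exists>k. hk_admissible H k"
proof -
  have fE: "finite (hedges H)"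
    by (rule finite_subset[of _ "Pow (hverts H)"]) (use finite_hverts hedges_subset in auto)
  then obtain h :: "'a set \<Rightarrow> nat" where h: "inj_on h (hedges H)"
    using finite_imp_inj_to_nat_seg[OF fE] by auto
  define H' :: "('a + nat) pre_hypergraph" where "H' = rename_vertices Inl H"
  define I :: "('a + nat) set" where "I = (\<lambda>e. Inr (h e)) ` hedges H"
  define A :: "(('a + nat) \<times> ('a + nat)) set" where
    "A = {(Inl x, Inr (h e)) | x e. e \<in> hedges H \<and> x \<in> e}"
  define D where "D = \<lparr>pverts = hverts H' \<union> I, parcs = A\<rparr>"
  have V: "hverts H' = Inl ` hverts H" and E: "hedges H' = (`) Inl ` hedges H"
    by (auto simp: H'_def rename_vertices_def)
  have "finite I" using fE by (simp add: I_def)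
  have sub: "A \<subseteq> pverts D \<times> pverts D"
    using hedges_subset by (auto simp: D_def A_def I_def V)
  have "finite (pverts D)"
    using \<open>finite I\<close> finite_hverts by (simp add: D_def V)
  moreover from this have "finite A" by (intro finite_subset[OF sub] finite_SigmaI)
  ultimately have "pair_fin_digraph D"
    using sub by unfold_locales (auto simp: D_def)
  moreover have "acyclic A"
  proof -
    have "A \<subseteq> measure (case_sum (\<lambda>_. 0) (\<lambda>_. 1))" by (auto simp: A_def)
    then show ?thesis by (intro wf_acyclic wf_subset[OF wf_measure])
  qed
  then have "acyclic (parcs D)" by (simp add: D_def)
  moreover have "add_isolated H' I = competition_hypergraph D"
  proof -
    have nbh_l: "in_neighborhood D (Inl x) = {}" for x
      by (auto simp: in_neighborhood_def D_def A_def)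
    have nbh_r: "in_neighborhood D (Inr (h e)) = Inl ` e" if e: "e \<in> hedges H" for e
    proof -
      have "(z, Inr (h e)) \<in> A \<longleftrightarrow> z \<in> Inl ` e" for z
        using e h unfolding A_def by (blast dest: inj_onD)
      moreover have "Inl ` e \<subseteq> pverts D"
        using hedges_subset[OF e] by (auto simp: D_def V)
      ultimately show ?thesis by (auto simp: in_neighborhood_def D_def)
    qed
    have card: "card (Inl ` e :: ('a + nat) set) = card e" for e
      by (simp add: card_image)
    have ex: "(\<exists>v\<in>pverts D. e = in_neighborhood D v) \<longleftrightarrow> e = {} \<and> hverts H \<noteq> {} \<or> e \<in> hedges H'" for e
      by (simp add: D_def V E I_def bex_Un nbh_l[unfolded D_def V I_def])
         (metis (no_types, lifting) D_def I_def V image_iff nbh_r ex_in_conv)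
    have "e \<subseteq> pverts D \<and> 2 \<le> card e" if "e \<in> hedges H'" for e
      using that hedges_subset hedges_card unfolding E D_def V by (force simp: card)
    moreover have "\<not> 2 \<le> card ({} :: ('a + nat) set)" by simp
    ultimately have "{e. e \<subseteq> pverts D \<and> 2 \<le> card e \<and> (\<exists>v\<in>pverts D. e = in_neighborhood D v)} = hedges H'"
      unfolding ex by blast
    then show ?thesis
      by (simp add: add_isolated_def competition_hypergraph_def) (simp add: D_def)
  qed
  ultimately have "is_acyclic_competition_hypergraph (add_isolated H' I)"
    unfolding is_acyclic_competition_hypergraph_def by blast
  moreover have "I \<inter> hverts H' = {}" by (auto simp: I_def V)
  ultimately show ?thesis
    using \<open>finite I\<close> unfolding hk_admissible_def Let_def H'_def by blast
qed

end

theory Submission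
  imports Defs
begin

text \<open>
  Suppose that adding \<open>k\<close> isolated vertices turns \<open>H\<close> into the competition hypergraph of an
  acyclic digraph \<open>D\<close>. Choose for every hyperedge a vertex of \<open>D\<close> whose in-neighborhood it is;
  distinct hyperedges get distinct vertices, so the set \<open>S\<close> of chosen vertices has as many
  elements as there are hyperedges. As \<open>D\<close> is acyclic, some \<open>s \<in> S\<close> has no in-neighbor in \<open>S\<close>.
  The in-neighborhood of \<open>s\<close> is a hyperedge disjoint from \<open>S\<close>, so \<open>D\<close> has at least as many
  vertices as there are hyperedges plus the size of a smallest hyperedge
  (\<open>competition_hypergraph_card_bound\<close>). On the other hand, \<open>D\<close> has \<open>card (hverts H) + k\<close>
  vertices. The bound thus holds for every admissible \<open>k\<close> (\<open>hk_admissible_lower_bound\<close>), in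
  particular for the least one.
\<close>

text \<open>
  No vertex is counted twice on the left: a set of vertices representing the hyperedges and the
  in-neighborhood of a source of the subdigraph induced by that set are disjoint.
\<close>

lemma competition_hypergraph_card_bound:
  assumes D: "pair_fin_digraph D" and acyc: "acyclic (parcs D)"
    and ne: "hedges (competition_hypergraph D) \<noteq> {}"
  shows "card (hedges (competition_hypergraph D)) + Min (card ` hedges (competition_hypergraph D))
           \<le> card (pverts D)"
proof -
  interpret pair_fin_digraph D by (rule D)
  let ?E = "hedges (competition_hypergraph D)"
  have "finite ?E"
    by (rule finite_subset[of _ "Pow (pverts D)"]) (auto simp: competition_hypergraph_def)
  have "\<forall>e\<in>?E. \<exists>v. v \<in> pverts D \<and> in_neighborhood D v = e"
    by (auto simp: competition_hypergraph_def)
  then obtain p where p: "\<And>e. e \<in> ?E \<Longrightarrow> p e \<in> pverts D"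
    and nbh: "\<And>e. e \<in> ?E \<Longrightarrow> in_neighborhood D (p e) = e"
    by metis
  define S where "S = p ` ?E"
  have "inj_on p ?E" by (metis inj_onI nbh)
  then have card_S: "card S = card ?E" unfolding S_def by (rule card_image)
  have "wf (parcs D)" using acyc by (simp add: finite_acyclic_wf)
  moreover have "S \<noteq> {}" using ne by (simp add: S_def)
  ultimately obtain s where s: "s \<in> S" and min: "\<And>x. (x, s) \<in> parcs D \<Longrightarrow> x \<notin> S"
    by (metis ex_in_conv wfE_min)
  from s obtain e where e: "e \<in> ?E" and "s = p e" by (auto simp: S_def)
  then have e_nbh: "e = in_neighborhood D s" using nbh by simp
  have S_sub: "S \<subseteq> pverts D" using p by (auto simp: S_def)
  have e_sub: "e \<subseteq> pverts D" by (auto simp: e_nbh in_neighborhood_def)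
  have "S \<inter> e = {}" using min by (auto simp: e_nbh in_neighborhood_def)
  then have "card S + card e = card (S \<union> e)"
    using S_sub e_sub by (simp add: card_Un_disjoint finite_subset[OF _ finite_verts])
  also have "\<dots> \<le> card (pverts D)" using S_sub e_sub by (simp add: card_mono)
  finally have "card ?E + card e \<le> card (pverts D)" by (simp add: card_S)
  moreover have "Min (card ` ?E) \<le> card e" using \<open>finite ?E\<close> e by simp
  ultimately show ?thesis by linarith
qed

lemma hk_admissible_lower_bound:
  fixes H :: "'a pre_hypergraph"
  assumes "hypergraph H" and ne: "hedges H \<noteq> {}" and "hk_admissible H k"
  shows "card (hedges H) + Min (card ` hedges H) \<le> card (hverts H) + k"
proof -
  interpret hypergraph H by fact
  define H' :: "('a + nat) pre_hypergraph" where "H' = rename_vertices Inl H"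
  from \<open>hk_admissible H k\<close> obtain I D where "finite I" "I \<inter> hverts H' = {}" "card I = k"
    and D: "pair_fin_digraph D" "acyclic (parcs D)"
    and eq: "add_isolated H' I = competition_hypergraph D"
    unfolding hk_admissible_def Let_def is_acyclic_competition_hypergraph_def H'_def by blast
  have V: "hverts H' = Inl ` hverts H" and E: "hedges H' = (`) Inl ` hedges H"
    by (auto simp: H'_def rename_vertices_def)
  have hedges_D: "hedges (competition_hypergraph D) = (`) Inl ` hedges H"
    by (simp add: eq[symmetric] add_isolated_def E)
  have "pverts D = hverts (competition_hypergraph D)" by (simp add: competition_hypergraph_def)
  also have "\<dots> = hverts H' \<union> I" by (simp add: eq[symmetric] add_isolated_def)
  also have "card \<dots> = card (hverts H') + card I"
    using \<open>finite I\<close> \<open>I \<inter> hverts H' = {}\<close> finite_hverts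
    by (intro card_Un_disjoint) (auto simp: V)
  also have "\<dots> = card (hverts H) + k" using \<open>card I = k\<close> by (simp add: V card_image)
  finally have card_V: "card (pverts D) = card (hverts H) + k" .
  have "inj_on ((`) (Inl :: 'a \<Rightarrow> 'a + nat)) (hedges H)"
    by (simp add: inj_on_def inj_image_eq_iff)
  then have card_E: "card (hedges (competition_hypergraph D)) = card (hedges H)"
    by (simp add: hedges_D card_image)
  have sizes: "card ` hedges (competition_hypergraph D) = card ` hedges H"
    by (simp add: hedges_D image_image card_image)
  show ?thesis
    using competition_hypergraph_card_bound[OF D] ne
    unfolding card_E sizes card_V by (simp add: hedges_D)
qed

theorem theorem2p1:
  fixes H :: "'a pre_hypergraph"
  assumes "hypergraph H"
    and "hedges H \<noteq> {}"
  shows "int (hypercompetition_number H)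
           \<ge> int (card (hedges H)) - int (card (hverts H)) + int (Min (card ` hedges H))"
proof -
  have "hk_admissible H (hypercompetition_number H)"
    unfolding hypercompetition_number_def
    using hypergraph.hk_admissible_exists[OF assms(1)] by (rule LeastI_ex)
  from hk_admissible_lower_bound[OF assms this] show ?thesis by linarith
qed

end
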